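(* Let $\lambda=\lambda_1\otimes\lambda_2$ be a product of finite, positive, nonzero measures on $\Omega=\Omega_1\times\Omega_2$. For arbitrary $f_\mu\in\mathcal{B}^2(\lambda)$ and $i\in\{1,2\}$, the geometric margin $f_{\mu,i}$ is the unique orthogonal projection of $f_\mu$ on $\mathcal{B}^2_{\{i\}}(\lambda)$. In particular, \[ f_{\mu,i}=\operatorname*{argmin}_{f\in\mathcal{B}^2_{\{i\}}(\lambda)}\|f_\mu\ominus f\|_{\mathcal{B}^2(\lambda)}. \]
   Context: Bayes space. For a finite, positive, nonzero measure $\lambda$ on a measurable space $(\Omega,\mathcal{A})$, $\mathcal{M}(\lambda)$ is the set of $\sigma$-finite positive measures $\mu$ on $(\Omega,\mathcal A)$ with the same null sets as $\lambda$; $\mu$ is identified with its $\lambda$-density $f_\mu=d\mu/d\lambda$. Write $f_\mu\propto f_\nu$ if $f_\mu=c f_\nu$ ($\lambda$-a.e.) for some $c\in(0,\infty)$. The Bayes space is $\mathcal{B}(\lambda)=\mathcal{M}(\lambda)/\!\propto$; equality of elements means $\propto$. Vector space operations: $f\oplus g\propto fg$, $\alpha\odot f\propto f^{\alpha}$, $f\ominus g=f\oplus((-1)\odot g)$; the neutral element is the constant density $1$. $\mathcal{B}^2(\lambda)=\{f\in\mathcal{B}(\lambda):\int_\Omega|\ln f|^2d\lambda<\infty\}$ is a Hilbert space with inner product $\langle f,g\rangle_{\mathcal{B}^2(\lambda)}=\frac{1}{2\lambda(\Omega)}\int_\Omega\int_\Omega \ln\{f(\omega)/f(\omega')\}\ln\{g(\omega)/g(\omega')\}\,d\lambda(\omega)\,d\lambda(\omega')$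 and induced norm $\|\cdot\|_{\mathcal{B}^2(\lambda)}$. Bivariate setting. $(\Omega_i,\mathcal{A}_i,\lambda_i)$, $i\in\{1,2\}$, are measurable spaces with finite, positive, nonzero measures; $\Omega=\Omega_1\times\Omega_2$, $\mathcal A=\mathcal A_1\otimes\mathcal A_2$, $\lambda=\lambda_1\otimes\lambda_2$. $\mathcal{B}^2_{\{1\}}(\lambda)=\{\mu_1\otimes\lambda_2:\mu_1\in\mathcal{B}^2(\lambda_1)\}$ and $\mathcal{B}^2_{\{2\}}(\lambda)=\{\lambda_1\otimes\mu_2:\mu_2\in\mathcal{B}^2(\lambda_2)\}$, subspaces of $\mathcal{B}^2(\lambda)$. Geometric margins of $f_\mu\in\mathcal{B}^2(\lambda)$: $f_{\mu,1}(\omega_1,\omega_2)\equiv f_{\mu,1}(\omega_1)\propto\exp[\frac1{\lambda_2(\Omega_2)}\int_{\Omega_2}\ln\{f_\mu(\omega_1,\omega^* )\}d\lambda_2(\omega^* )]$ and $f_{\mu,2}(\omega_1,\omega_2)\equiv f_{\mu,2}(\omega_2)\propto\exp[\frac1{\lambda_1(\Omega_1)}\int_{\Omega_1}\ln\{f_\mu(\omega^*,\omega_2)\}d\lambda_1(\omega^* )]$. *)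

theory Defs
  imports "HOL-Analysis.Analysis"
begin

definition bayes_measures :: "'a measure \<Rightarrow> 'a measure set" where
  "bayes_measures L =
     {\<mu>. sigma_finite_measure \<mu> \<and> sets \<mu> = sets L \<and> null_sets \<mu> = null_sets L}"

text \<open>For \<open>\<mu>\<close> in \<open>bayes_measures L\<close> the Radon-Nikodym derivative lies strictly between
  zero and infinity \<open>L\<close>-almost everywhere, so converting it to a real number alters it on an
  \<open>L\<close>-null set only.\<close>

definition bayes_density :: "'a measure \<Rightarrow> 'a measure \<Rightarrow> 'a \<Rightarrow> real" where
  "bayes_density L \<mu> = (\<lambda>x. enn2real (RN_deriv L \<mu> x))"

definition bayes_prop :: "'a measure \<Rightarrow> ('a \<Rightarrow> real) \<Rightarrow> ('a \<Rightarrow> real) \<Rightarrow> bool" where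
  "bayes_prop L f g \<longleftrightarrow> (\<exists>c>0. AE x in L. f x = c * g x)"

definition bayes_rel :: "'a measure \<Rightarrow> ('a measure \<times> 'a measure) set" where
  "bayes_rel L = {(\<mu>, \<nu>). \<mu> \<in> bayes_measures L \<and> \<nu> \<in> bayes_measures L \<and>
                          bayes_prop L (bayes_density L \<mu>) (bayes_density L \<nu>)}"

definition bayes_space :: "'a measure \<Rightarrow> 'a measure set set" where
  "bayes_space L = bayes_measures L // bayes_rel L"

definition bayes_class :: "'a measure \<Rightarrow> ('a \<Rightarrow> real) \<Rightarrow> 'a measure set" where
  "bayes_class L f = bayes_rel L `` {density L (\<lambda>x. ennreal (f x))}"

text \<open>Operations are lifted to equivalence classes by taking the union (or, for the real-valued
  inner product, the unique value) over all representatives. No representative is chosen, and the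
  result is meaningful only because the operations respect proportionality.\<close>

definition bayes_plus :: "'a measure \<Rightarrow> 'a measure set \<Rightarrow> 'a measure set \<Rightarrow> 'a measure set" where
  "bayes_plus L A B =
     (\<Union>\<mu>\<in>A. \<Union>\<nu>\<in>B. bayes_class L (\<lambda>x. bayes_density L \<mu> x * bayes_density L \<nu> x))"

definition bayes_scale :: "'a measure \<Rightarrow> real \<Rightarrow> 'a measure set \<Rightarrow> 'a measure set" where
  "bayes_scale L \<alpha> A = (\<Union>\<mu>\<in>A. bayes_class L (\<lambda>x. bayes_density L \<mu> x powr \<alpha>))"

definition bayes_minus :: "'a measure \<Rightarrow> 'a measure set \<Rightarrow> 'a measure set \<Rightarrow> 'a measure set" where
  "bayes_minus L A B = bayes_plus L A (bayes_scale L (- 1) B)"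

definition bayes2 :: "'a measure \<Rightarrow> 'a measure set set" where
  "bayes2 L = {A \<in> bayes_space L.
     \<forall>\<mu>\<in>A. (\<integral>\<^sup>+ x. ennreal (\<bar>ln (bayes_density L \<mu> x)\<bar>\<^sup>2) \<partial>L) < \<infinity>}"

definition density_inner :: "'a measure \<Rightarrow> ('a \<Rightarrow> real) \<Rightarrow> ('a \<Rightarrow> real) \<Rightarrow> real" where
  "density_inner L f g =
     1 / (2 * measure L (space L)) *
       (\<integral>x'. (\<integral>x. ln (f x / f x') * ln (g x / g x') \<partial>L) \<partial>L)"

definition bayes_inner :: "'a measure \<Rightarrow> 'a measure set \<Rightarrow> 'a measure set \<Rightarrow> real" where
  "bayes_inner L A B =
     the_elem ((\<lambda>(\<mu>, \<nu>). density_inner L (bayes_density L \<mu>) (bayes_density L \<nu>)) ` (A \<times> B))"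

definition bayes_norm :: "'a measure \<Rightarrow> 'a measure set \<Rightarrow> real" where
  "bayes_norm L A = sqrt (bayes_inner L A A)"

definition is_orthogonal_projection ::
  "'a measure \<Rightarrow> 'a measure set set \<Rightarrow> 'a measure set \<Rightarrow> 'a measure set \<Rightarrow> bool" where
  "is_orthogonal_projection L S A P \<longleftrightarrow>
     P \<in> S \<and> (\<forall>B\<in>S. bayes_inner L (bayes_minus L A P) B = 0)"

text \<open>In the two definitions below the index is meant to be \<open>1\<close> or \<open>2\<close>.\<close>

definition bayes2_marginal ::
  "'a measure \<Rightarrow> 'b measure \<Rightarrow> nat \<Rightarrow> ('a \<times> 'b) measure set set" where
  "bayes2_marginal L1 L2 i =
     (if i = 1
      then {bayes_rel (L1 \<Otimes>\<^sub>M L2) `` {\<mu>1 \<Otimes>\<^sub>M L2} | A \<mu>1. A \<in> bayes2 L1 \<and> \<mu>1 \<in> A}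
      else {bayes_rel (L1 \<Otimes>\<^sub>M L2) `` {L1 \<Otimes>\<^sub>M \<mu>2} | A \<mu>2. A \<in> bayes2 L2 \<and> \<mu>2 \<in> A})"

definition margin_density ::
  "'a measure \<Rightarrow> 'b measure \<Rightarrow> nat \<Rightarrow> ('a \<times> 'b \<Rightarrow> real) \<Rightarrow> 'a \<times> 'b \<Rightarrow> real" where
  "margin_density L1 L2 i f =
     (\<lambda>(x, y).
        if i = 1
        then exp (1 / measure L2 (space L2) * (\<integral>w. ln (f (x, w)) \<partial>L2))
        else exp (1 / measure L1 (space L1) * (\<integral>w. ln (f (w, y)) \<partial>L1)))"

definition geometric_margin ::
  "'a measure \<Rightarrow> 'b measure \<Rightarrow> nat \<Rightarrow> ('a \<times> 'b) measure set \<Rightarrow> ('a \<times> 'b) measure set" where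
  "geometric_margin L1 L2 i A =
     (\<Union>\<mu>\<in>A. bayes_class (L1 \<Otimes>\<^sub>M L2)
        (margin_density L1 L2 i (bayes_density (L1 \<Otimes>\<^sub>M L2) \<mu>)))"

end

theory Submission
  imports Defs
begin

text \<open>
  The map sending a square integrable \<open>u\<close> to the class of the measure with density \<open>exp u\<close>
  identifies \<open>\<B>\<^sup>2(\<lambda>)\<close> with \<open>L\<^sup>2(\<lambda>)\<close> modulo additive constants. It turns the difference of
  Bayes elements into the difference of functions, and the double integral of log-ratios into the
  (unnormalised) covariance \<open>\<integral> u v - (\<integral> u) (\<integral> v) / \<lambda>(\<Omega>)\<close>, which vanishes at \<open>(u, u)\<close> only if
  \<open>u\<close> is almost everywhere constant (lemmas \<open>bayes_minus_log_class\<close>,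
  \<open>bayes_inner_log_class\<close>, \<open>log_covariance_definite\<close>).

  In these coordinates the marginal subspaces consist of the functions of one coordinate, and
  the geometric margin replaces \<open>u\<close> by its average \<open>p\<close> over the other coordinate. By Fubini, \<open>u - p\<close>
  is covariance-orthogonal to every function of the retained coordinate
  (\<open>log_covariance_residual_fst\<close>), so Pythagoras yields both characterisations, with uniqueness
  coming from definiteness (\<open>log_class_projection\<close>).

  A geometric margin is formed as a union over all representatives of the given class. Each
  representative yields an orthogonal projection, and since the projection is unique, all members
  of the union coincide.
\<close>

section \<open>Log-densities as coordinates on the Bayes space\<close>

definition square_int :: "'a measure \<Rightarrow> ('a \<Rightarrow> real) set" where
  "square_int M = {u \<in> borel_measurable M. integrable M (\<lambda>x. (u x)\<^sup>2)}"

definition log_class :: "'a measure \<Rightarrow> ('a \<Rightarrow> real) \<Rightarrow> 'a measure set" where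
  "log_class M u = bayes_class M (\<lambda>x. exp (u x))"

definition log_covariance :: "'a measure \<Rightarrow> ('a \<Rightarrow> real) \<Rightarrow> ('a \<Rightarrow> real) \<Rightarrow> real" where
  "log_covariance M u v =
     (\<integral>x. u x * v x \<partial>M) - (\<integral>x. u x \<partial>M) * (\<integral>x. v x \<partial>M) / measure M (space M)"

lemma borel_measurable_bayes_density [measurable]: "bayes_density M \<mu> \<in> borel_measurable M"
  unfolding bayes_density_def by measurable

lemma (in sigma_finite_measure) bayes_measures_density:
  assumes "\<mu> \<in> bayes_measures M"
  shows density_bayes_density: "density M (\<lambda>x. ennreal (bayes_density M \<mu> x)) = \<mu>"
    and bayes_density_pos: "AE x in M. 0 < bayes_density M \<mu> x"
proof -
  have s: "sigma_finite_measure \<mu>" and sets: "sets \<mu> = sets M" and null: "null_sets \<mu> = null_sets M"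
    using assms by (auto simp: bayes_measures_def)
  have ac: "absolutely_continuous M \<mu>"
    using null by (simp add: absolutely_continuous_def)
  have fin: "AE x in M. RN_deriv M \<mu> x \<noteq> \<infinity>"
    by (rule RN_deriv_finite[OF s ac sets])
  have dens: "density M (RN_deriv M \<mu>) = \<mu>"
    by (rule density_RN_deriv[OF ac sets])
  have "density M (\<lambda>x. ennreal (bayes_density M \<mu> x)) = density M (RN_deriv M \<mu>)"
    using fin by (intro density_cong) (auto simp: bayes_density_def less_top elim!: eventually_mono)
  with dens show "density M (\<lambda>x. ennreal (bayes_density M \<mu> x)) = \<mu>"
    by simp
  let ?Z = "{x \<in> space M. RN_deriv M \<mu> x = 0}"
  have "?Z \<in> null_sets (density M (RN_deriv M \<mu>))"
    by (subst null_sets_density_iff) auto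
  then have "?Z \<in> null_sets M"
    by (simp add: dens null)
  then have "AE x in M. x \<notin> ?Z"
    by (rule AE_not_in)
  with fin AE_space show "AE x in M. 0 < bayes_density M \<mu> x"
    by eventually_elim (auto simp: bayes_density_def enn2real_positive_iff less_top zero_less_iff_neq_zero)
qed

lemma (in sigma_finite_measure) density_in_bayes_measures:
  assumes [measurable]: "f \<in> borel_measurable M" and pos: "AE x in M. (0::real) < f x"
  shows "density M (\<lambda>x. ennreal (f x)) \<in> bayes_measures M"
    and bayes_density_density: "AE x in M. bayes_density M (density M (\<lambda>x. ennreal (f x))) x = f x"
proof -
  have "sigma_finite_measure (density M (\<lambda>x. ennreal (f x)))"
    by (subst sigma_finite_iff_density_finite) auto
  moreover have "null_sets (density M (\<lambda>x. ennreal (f x))) = null_sets M"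
  proof (rule set_eqI)
    fix A
    have "(AE x in M. x \<in> A \<longrightarrow> ennreal (f x) = 0) \<longleftrightarrow> (AE x in M. x \<notin> A)"
      by (rule eventually_subst) (use pos in \<open>auto elim!: eventually_mono simp: ennreal_eq_0_iff\<close>)
    then show "A \<in> null_sets (density M (\<lambda>x. ennreal (f x))) \<longleftrightarrow> A \<in> null_sets M"
      by (subst null_sets_density_iff) (simp, use AE_iff_null_sets in blast)
  qed
  ultimately show "density M (\<lambda>x. ennreal (f x)) \<in> bayes_measures M"
    by (simp add: bayes_measures_def)
  have "AE x in M. ennreal (f x) = RN_deriv M (density M (\<lambda>x. ennreal (f x))) x"
    by (rule RN_deriv_unique) auto
  with pos show "AE x in M. bayes_density M (density M (\<lambda>x. ennreal (f x))) x = f x"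
    by eventually_elim (metis bayes_density_def enn2real_ennreal less_imp_le)
qed

text \<open>A scaling factor \<open>c > 0\<close> of densities is a translation by \<open>ln c\<close> of log-densities.\<close>

lemma (in sigma_finite_measure) mem_bayes_class:
  assumes f [measurable]: "f \<in> borel_measurable M" and [measurable]: "u \<in> borel_measurable M"
    and fu: "AE x in M. f x = exp (u x + c)"
  shows "\<mu> \<in> bayes_class M f \<longleftrightarrow>
    \<mu> \<in> bayes_measures M \<and> (\<exists>d. AE x in M. bayes_density M \<mu> x = exp (u x + d))"
proof -
  let ?D = "density M (\<lambda>x. ennreal (f x))"
  have pos: "AE x in M. 0 < f x"
    using fu by eventually_elim simp
  have D: "?D \<in> bayes_measures M" "AE x in M. bayes_density M ?D x = exp (u x + c)"
    using density_in_bayes_measures[OF f pos] bayes_density_density[OF f pos] fu by auto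
  have "(\<exists>k>0. AE x in M. bayes_density M ?D x = k * bayes_density M \<mu> x) \<longleftrightarrow>
      (\<exists>d. AE x in M. bayes_density M \<mu> x = exp (u x + d))"
  proof safe
    fix k :: real assume "k > 0" "AE x in M. bayes_density M ?D x = k * bayes_density M \<mu> x"
    with D(2) have "AE x in M. bayes_density M \<mu> x = exp (u x + (c - ln k))"
      by (auto elim!: eventually_elim2 simp: exp_add exp_diff field_simps)
    then show "\<exists>d. AE x in M. bayes_density M \<mu> x = exp (u x + d)" ..
  next
    fix d assume "AE x in M. bayes_density M \<mu> x = exp (u x + d)"
    with D(2) have "AE x in M. bayes_density M ?D x = exp (c - d) * bayes_density M \<mu> x"
      by eventually_elim (simp flip: exp_add)
    then show "\<exists>k>0. AE x in M. bayes_density M ?D x = k * bayes_density M \<mu> x"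
      by (intro exI[of _ "exp (c - d)"]) simp
  qed
  with D(1) show ?thesis
    by (auto simp: bayes_class_def bayes_rel_def bayes_prop_def)
qed

lemma (in sigma_finite_measure) mem_log_class:
  assumes "u \<in> borel_measurable M"
  shows "\<mu> \<in> log_class M u \<longleftrightarrow>
    \<mu> \<in> bayes_measures M \<and> (\<exists>d. AE x in M. bayes_density M \<mu> x = exp (u x + d))"
  unfolding log_class_def by (rule mem_bayes_class[where c = 0]) (use assms in auto)

lemma (in sigma_finite_measure) bayes_class_eq_log_class:
  assumes "f \<in> borel_measurable M" and "u \<in> borel_measurable M"
    and "AE x in M. f x = exp (u x + c)"
  shows "bayes_class M f = log_class M u"
  using mem_bayes_class[OF assms] mem_log_class[OF assms(2)] by blast

lemma (in sigma_finite_measure) density_exp_in_log_class: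
  assumes [measurable]: "u \<in> borel_measurable M"
  shows "density M (\<lambda>x. ennreal (exp (u x))) \<in> log_class M u"
proof -
  have "AE x in M. bayes_density M (density M (\<lambda>x. ennreal (exp (u x)))) x = exp (u x + 0)"
    using bayes_density_density[of "\<lambda>x. exp (u x)"] by simp
  then show ?thesis
    using density_in_bayes_measures[of "\<lambda>x. exp (u x)"] by (subst mem_log_class) auto
qed

lemma (in sigma_finite_measure) log_class_translate:
  assumes [measurable]: "u \<in> borel_measurable M" "v \<in> borel_measurable M"
    and uv: "AE x in M. u x - v x = c"
  shows "log_class M u = log_class M v"
proof -
  have "AE x in M. exp (u x) = exp (v x + c)"
    using uv by eventually_elim (simp add: algebra_simps)
  then show ?thesis
    unfolding log_class_def[of M u] by (intro bayes_class_eq_log_class) auto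
qed

lemma (in sigma_finite_measure) bayes_rel_class_eq_log_class:
  assumes "\<mu> \<in> bayes_measures M"
  shows "bayes_rel M `` {\<mu>} = log_class M (\<lambda>x. ln (bayes_density M \<mu> x))"
proof -
  have "bayes_rel M `` {\<mu>} = bayes_class M (bayes_density M \<mu>)"
    using density_bayes_density[OF assms] by (simp add: bayes_class_def)
  also have "\<dots> = log_class M (\<lambda>x. ln (bayes_density M \<mu> x))"
    using bayes_density_pos[OF assms] by (intro bayes_class_eq_log_class[where c = 0]) auto
  finally show ?thesis .
qed

lemma square_int_measurable: "u \<in> square_int M \<Longrightarrow> u \<in> borel_measurable M"
  by (simp add: square_int_def)

lemma square_int_cong_AE:
  assumes "u \<in> square_int M" "v \<in> borel_measurable M" "AE x in M. u x = v x"
  shows "v \<in> square_int M"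
proof -
  have "integrable M (\<lambda>x. (v x)\<^sup>2) \<longleftrightarrow> integrable M (\<lambda>x. (u x)\<^sup>2)"
    using assms by (intro integrable_cong_AE) (auto simp: square_int_def elim!: eventually_mono)
  with assms show ?thesis by (simp add: square_int_def)
qed

lemma square_int_iff_nn_integral:
  assumes [measurable]: "u \<in> borel_measurable M"
  shows "u \<in> square_int M \<longleftrightarrow> (\<integral>\<^sup>+ x. ennreal (\<bar>u x\<bar>\<^sup>2) \<partial>M) < \<infinity>"
  by (simp add: square_int_def integrable_iff_bounded)

lemma integrable_square_int_mult:
  assumes "u \<in> square_int M" "v \<in> square_int M"
  shows "integrable M (\<lambda>x. u x * v x)"
proof (rule Bochner_Integration.integrable_bound)
  show "integrable M (\<lambda>x. (u x)\<^sup>2 + (v x)\<^sup>2)"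
    using assms by (simp add: square_int_def)
  show "(\<lambda>x. u x * v x) \<in> borel_measurable M"
    using assms[THEN square_int_measurable] by measurable
  have "\<bar>a * b\<bar> \<le> a\<^sup>2 + b\<^sup>2" for a b :: real
  proof -
    have "2 * \<bar>a * b\<bar> \<le> a\<^sup>2 + b\<^sup>2"
      using sum_squares_bound[of "\<bar>a\<bar>" "\<bar>b\<bar>"] by (simp add: abs_mult mult.assoc)
    then show ?thesis
      using abs_ge_zero[of "a * b"] by linarith
  qed
  then show "AE x in M. norm (u x * v x) \<le> norm ((u x)\<^sup>2 + (v x)\<^sup>2)"
    by simp
qed

lemma square_int_diff:
  assumes "u \<in> square_int M" "v \<in> square_int M"
  shows "(\<lambda>x. u x - v x) \<in> square_int M"
proof -
  have "integrable M (\<lambda>x. (u x)\<^sup>2 + (v x)\<^sup>2 - 2 * (u x * v x))"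
    using assms integrable_square_int_mult[OF assms] by (simp add: square_int_def)
  moreover have "(\<lambda>x. u x - v x) \<in> borel_measurable M"
    using assms[THEN square_int_measurable] by measurable
  ultimately show ?thesis
    by (simp add: square_int_def power2_diff mult.assoc)
qed

lemma (in finite_measure) integrable_square_int:
  "u \<in> square_int M \<Longrightarrow> integrable M u"
  by (auto simp: square_int_def intro: square_integrable_imp_integrable)

lemma (in finite_measure) square_int_const: "(\<lambda>x. c) \<in> square_int M"
  by (simp add: square_int_def)

lemma (in finite_measure) square_int_add_const:
  assumes "u \<in> square_int M"
  shows "(\<lambda>x. u x + c) \<in> square_int M"
  using square_int_diff[OF assms square_int_const[of "- c"]] by simp

lemma (in finite_measure) bayes2_representative:
  assumes "A \<in> bayes2 M" and mu: "\<mu> \<in> A"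
  shows "\<mu> \<in> bayes_measures M"
    and "(\<lambda>x. ln (bayes_density M \<mu> x)) \<in> square_int M"
    and "A = log_class M (\<lambda>x. ln (bayes_density M \<mu> x))"
proof -
  let ?u = "\<lambda>x. ln (bayes_density M \<mu> x)"
  obtain \<nu> where nu: "\<nu> \<in> bayes_measures M" and A: "A = bayes_rel M `` {\<nu>}"
    using assms(1) by (auto simp: bayes2_def bayes_space_def quotient_def)
  let ?v = "\<lambda>x. ln (bayes_density M \<nu> x)"
  have Av: "A = log_class M ?v"
    using bayes_rel_class_eq_log_class[OF nu] A by simp
  then obtain d where d: "AE x in M. bayes_density M \<mu> x = exp (?v x + d)"
    using mu by (auto simp: mem_log_class)
  show "\<mu> \<in> bayes_measures M"
    using mu Av by (simp add: mem_log_class)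
  have "AE x in M. ?u x - ?v x = d"
    using d by eventually_elim simp
  then show "A = log_class M ?u"
    using Av log_class_translate[of ?u ?v d] by simp
  show "?u \<in> square_int M"
    using assms by (subst square_int_iff_nn_integral) (auto simp: bayes2_def)
qed

lemma bayes2_nonempty:
  assumes "finite_measure M" "A \<in> bayes2 M"
  obtains \<mu> where "\<mu> \<in> A"
proof -
  interpret finite_measure M by fact
  obtain \<nu> where "\<nu> \<in> bayes_measures M" "A = bayes_rel M `` {\<nu>}"
    using assms(2) by (auto simp: bayes2_def bayes_space_def quotient_def)
  then have "A = log_class M (\<lambda>x. ln (bayes_density M \<nu> x))"
    using bayes_rel_class_eq_log_class by simp
  then show thesis
    using density_exp_in_log_class[of "\<lambda>x. ln (bayes_density M \<nu> x)"] by (auto intro: that)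
qed

lemma (in finite_measure) log_class_in_bayes2:
  assumes u: "u \<in> square_int M"
  shows "log_class M u \<in> bayes2 M"
proof -
  note [measurable] = square_int_measurable[OF u]
  let ?D = "density M (\<lambda>x. ennreal (exp (u x)))"
  have "?D \<in> bayes_measures M"
    using density_exp_in_log_class[of u] by (simp add: mem_log_class)
  then have "log_class M u \<in> bayes_space M"
    unfolding log_class_def bayes_class_def bayes_space_def by (rule quotientI)
  moreover have "(\<integral>\<^sup>+ x. ennreal (\<bar>ln (bayes_density M \<mu> x)\<bar>\<^sup>2) \<partial>M) < \<infinity>"
    if mu: "\<mu> \<in> log_class M u" for \<mu>
  proof -
    obtain d where "AE x in M. bayes_density M \<mu> x = exp (u x + d)"
      using mu by (auto simp: mem_log_class)
    then have "AE x in M. u x + d = ln (bayes_density M \<mu> x)"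
      by eventually_elim simp
    then have "(\<lambda>x. ln (bayes_density M \<mu> x)) \<in> square_int M"
      by (intro square_int_cong_AE[OF square_int_add_const[OF u]]) auto
    then show ?thesis
      by (subst (asm) square_int_iff_nn_integral) auto
  qed
  ultimately show ?thesis
    by (simp add: bayes2_def)
qed

section \<open>Operations and inner product in log coordinates\<close>

lemma (in sigma_finite_measure) bayes_scale_log_class:
  assumes [measurable]: "v \<in> borel_measurable M"
  shows "bayes_scale M a (log_class M v) = log_class M (\<lambda>x. a * v x)"
proof -
  have "bayes_class M (\<lambda>x. bayes_density M \<nu> x powr a) = log_class M (\<lambda>x. a * v x)"
    if nu: "\<nu> \<in> log_class M v" for \<nu>
  proof -
    obtain d where "AE x in M. bayes_density M \<nu> x = exp (v x + d)"
      using nu by (auto simp: mem_log_class)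
    then have "AE x in M. bayes_density M \<nu> x powr a = exp (a * v x + a * d)"
      by eventually_elim (simp add: powr_def algebra_simps)
    then show ?thesis
      by (intro bayes_class_eq_log_class) auto
  qed
  then show ?thesis
    unfolding bayes_scale_def using density_exp_in_log_class[of v] by auto
qed

lemma (in sigma_finite_measure) bayes_plus_log_class:
  assumes [measurable]: "u \<in> borel_measurable M" "v \<in> borel_measurable M"
  shows "bayes_plus M (log_class M u) (log_class M v) = log_class M (\<lambda>x. u x + v x)"
proof -
  have "bayes_class M (\<lambda>x. bayes_density M \<mu> x * bayes_density M \<nu> x) = log_class M (\<lambda>x. u x + v x)"
    if mu: "\<mu> \<in> log_class M u" and nu: "\<nu> \<in> log_class M v" for \<mu> \<nu>
  proof -
    obtain c d where "AE x in M. bayes_density M \<mu> x = exp (u x + c)"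
      "AE x in M. bayes_density M \<nu> x = exp (v x + d)"
      using mu nu by (auto simp: mem_log_class)
    then have "AE x in M. bayes_density M \<mu> x * bayes_density M \<nu> x = exp (u x + v x + (c + d))"
      by eventually_elim (simp flip: exp_add)
    then show ?thesis
      by (intro bayes_class_eq_log_class) auto
  qed
  then show ?thesis
    unfolding bayes_plus_def
    using density_exp_in_log_class[of u] density_exp_in_log_class[of v] by auto
qed

lemma (in sigma_finite_measure) bayes_minus_log_class:
  assumes "u \<in> borel_measurable M" "v \<in> borel_measurable M"
  shows "bayes_minus M (log_class M u) (log_class M v) = log_class M (\<lambda>x. u x - v x)"
  using assms by (simp add: bayes_minus_def bayes_scale_log_class bayes_plus_log_class)

text \<open>The log-ratios cancel the scaling constants. Expanding
  \<open>(u x - u x') (v x - v x')\<close>, both diagonal terms integrate to \<open>\<lambda>(\<Omega>) \<integral> u v\<close> and both mixed terms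
  to \<open>(\<integral> u) (\<integral> v)\<close>.\<close>

lemma (in finite_measure) density_inner_eq_log_covariance:
  assumes m: "measure M (space M) > 0"
    and u: "u \<in> square_int M" and v: "v \<in> square_int M"
    and [measurable]: "f \<in> borel_measurable M" "g \<in> borel_measurable M"
    and f: "AE x in M. f x = exp (u x + c)" and g: "AE x in M. g x = exp (v x + d)"
  shows "density_inner M f g = log_covariance M u v"
proof -
  let ?m = "measure M (space M)"
  let ?U = "\<integral>x. u x \<partial>M" and ?V = "\<integral>x. v x \<partial>M" and ?W = "\<integral>x. u x * v x \<partial>M"
  note [measurable] = square_int_measurable[OF u] square_int_measurable[OF v]
  have [simp]: "integrable M u" "integrable M v" "integrable M (\<lambda>x. u x * v x)"
    using u v by (auto intro: integrable_square_int integrable_square_int_mult)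
  have inner: "(\<integral>x. ln (f x / f x') * ln (g x / g x') \<partial>M) =
      ?W - v x' * ?U - u x' * ?V + ?m * (u x' * v x')"
    if x': "f x' = exp (u x' + c)" "g x' = exp (v x' + d)" for x'
  proof -
    have "(\<integral>x. ln (f x / f x') * ln (g x / g x') \<partial>M) =
        (\<integral>x. u x * v x - v x' * u x - u x' * v x + u x' * v x' \<partial>M)"
    proof (rule integral_cong_AE)
      show "AE x in M. ln (f x / f x') * ln (g x / g x') =
          u x * v x - v x' * u x - u x' * v x + u x' * v x'"
        using f g by eventually_elim (simp add: x' flip: exp_diff, simp add: algebra_simps)
    qed measurable
    then show ?thesis by simp
  qed
  have "(\<integral>x'. (\<integral>x. ln (f x / f x') * ln (g x / g x') \<partial>M) \<partial>M) =
      (\<integral>x'. ?W - v x' * ?U - u x' * ?V + ?m * (u x' * v x') \<partial>M)"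
  proof (rule integral_cong_AE)
    show "AE x' in M. (\<integral>x. ln (f x / f x') * ln (g x / g x') \<partial>M) =
        ?W - v x' * ?U - u x' * ?V + ?m * (u x' * v x')"
      using f g by eventually_elim (rule inner)
  qed measurable
  also have "\<dots> = ?m * ?W - ?V * ?U - ?U * ?V + ?m * ?W"
    by simp
  finally show ?thesis
    using m by (simp add: density_inner_def log_covariance_def field_simps)
qed

lemma (in finite_measure) bayes_inner_log_class:
  assumes m: "measure M (space M) > 0"
    and u: "u \<in> square_int M" and v: "v \<in> square_int M"
  shows "bayes_inner M (log_class M u) (log_class M v) = log_covariance M u v"
proof -
  note [measurable] = square_int_measurable[OF u] square_int_measurable[OF v]
  have "density_inner M (bayes_density M \<mu>) (bayes_density M \<nu>) = log_covariance M u v"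
    if mu: "\<mu> \<in> log_class M u" and nu: "\<nu> \<in> log_class M v" for \<mu> \<nu>
  proof -
    obtain c d where "AE x in M. bayes_density M \<mu> x = exp (u x + c)"
      "AE x in M. bayes_density M \<nu> x = exp (v x + d)"
      using mu nu by (auto simp: mem_log_class)
    then show ?thesis
      by (intro density_inner_eq_log_covariance[OF m u v]) auto
  qed
  moreover have "density M (\<lambda>x. ennreal (exp (u x))) \<in> log_class M u"
    "density M (\<lambda>x. ennreal (exp (v x))) \<in> log_class M v"
    by (auto intro: density_exp_in_log_class)
  ultimately have "(\<lambda>(\<mu>, \<nu>). density_inner M (bayes_density M \<mu>) (bayes_density M \<nu>)) `
      (log_class M u \<times> log_class M v) = {log_covariance M u v}"
    by force
  then show ?thesis
    by (simp add: bayes_inner_def)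
qed

lemma (in finite_measure) log_covariance_diff_left:
  assumes "a \<in> square_int M" "b \<in> square_int M" "v \<in> square_int M"
  shows "log_covariance M (\<lambda>x. a x - b x) v = log_covariance M a v - log_covariance M b v"
  using assms
  by (simp add: log_covariance_def left_diff_distrib integrable_square_int
      integrable_square_int_mult diff_divide_distrib)

lemma log_covariance_commute: "log_covariance M u v = log_covariance M v u"
  by (simp add: log_covariance_def mult.commute)

lemma (in finite_measure) log_covariance_eq_integral_square:
  assumes m: "measure M (space M) > 0" and u: "u \<in> square_int M"
  shows "log_covariance M u u = (\<integral>x. (u x - (\<integral>y. u y \<partial>M) / measure M (space M))\<^sup>2 \<partial>M)"
proof -
  let ?a = "(\<integral>y. u y \<partial>M) / measure M (space M)"
  have [simp]: "integrable M u" "integrable M (\<lambda>x. u x * u x)"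
    using u by (auto intro: integrable_square_int integrable_square_int_mult)
  have "(\<integral>x. (u x - ?a)\<^sup>2 \<partial>M) = (\<integral>x. u x * u x - (2 * ?a) * u x + ?a * ?a \<partial>M)"
    by (intro Bochner_Integration.integral_cong) (auto simp: power2_eq_square algebra_simps)
  also have "\<dots> = (\<integral>x. u x * u x \<partial>M) - 2 * ?a * (\<integral>x. u x \<partial>M) + measure M (space M) * (?a * ?a)"
    by simp
  finally show ?thesis
    using m by (simp add: log_covariance_def field_simps)
qed

lemma (in finite_measure) log_covariance_nonneg:
  assumes "measure M (space M) > 0" "u \<in> square_int M"
  shows "0 \<le> log_covariance M u u"
  by (simp add: log_covariance_eq_integral_square[OF assms])

lemma (in finite_measure) log_covariance_definite:
  assumes "measure M (space M) > 0" and u: "u \<in> square_int M" and "log_covariance M u u = 0"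
  shows "\<exists>c. AE x in M. u x = c"
proof -
  let ?a = "(\<integral>y. u y \<partial>M) / measure M (space M)"
  have "(\<integral>x. (u x - ?a)\<^sup>2 \<partial>M) = 0"
    using assms log_covariance_eq_integral_square by simp
  moreover have "integrable M (\<lambda>x. (u x - ?a)\<^sup>2)"
    using square_int_diff[OF u square_int_const[of ?a]] by (simp add: square_int_def)
  ultimately have "AE x in M. (u x - ?a)\<^sup>2 = 0"
    by (subst (asm) integral_nonneg_eq_0_iff_AE) auto
  then have "AE x in M. u x = ?a"
    by eventually_elim simp
  then show ?thesis ..
qed

text \<open>The projection theorem in log coordinates. For \<open>q \<in> V\<close>, orthogonality of \<open>u - p\<close> to
  \<open>p - q \<in> V\<close> gives Pythagoras, \<open>\<parallel>u - q\<parallel>\<^sup>2 = \<parallel>u - p\<parallel>\<^sup>2 + \<parallel>p - q\<parallel>\<^sup>2\<close>. Any other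
  projection or minimiser \<open>q\<close> thus satisfies \<open>\<parallel>p - q\<parallel> = 0\<close>, and so differs from \<open>p\<close> by a constant
  only, which the Bayes class ignores.\<close>

lemma (in finite_measure) log_class_projection:
  assumes m: "measure M (space M) > 0"
    and u: "u \<in> square_int M" and V: "V \<subseteq> square_int M" and p: "p \<in> V"
    and diff: "\<And>v w. v \<in> V \<Longrightarrow> w \<in> V \<Longrightarrow> (\<lambda>x. v x - w x) \<in> V"
    and orth: "\<And>v. v \<in> V \<Longrightarrow> log_covariance M (\<lambda>x. u x - p x) v = 0"
  shows "is_orthogonal_projection M (log_class M ` V) (log_class M u) P \<longleftrightarrow> P = log_class M p"
    and "is_arg_min (\<lambda>G. bayes_norm M (bayes_minus M (log_class M u) G))
           (\<lambda>G. G \<in> log_class M ` V) P \<longleftrightarrow> P = log_class M p"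
proof -
  have VD: "v \<in> square_int M" if "v \<in> V" for v
    using that V by blast
  have ps: "p \<in> square_int M"
    using p by (rule VD)
  have inner: "bayes_inner M (bayes_minus M (log_class M u) (log_class M q)) (log_class M v) =
      log_covariance M (\<lambda>x. u x - q x) v" if "q \<in> V" "v \<in> V" for q v
    using u VD[OF that(1)] VD[OF that(2)]
    by (simp add: bayes_minus_log_class square_int_measurable bayes_inner_log_class m square_int_diff)
  have norm: "bayes_norm M (bayes_minus M (log_class M u) (log_class M q)) =
      sqrt (log_covariance M (\<lambda>x. u x - q x) (\<lambda>x. u x - q x))" if "q \<in> V" for q
    using u VD[OF that]
    by (simp add: bayes_norm_def bayes_minus_log_class square_int_measurable
        bayes_inner_log_class m square_int_diff)
  have eqI: "log_class M q = log_class M p"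
    if q: "q \<in> V" and zero: "log_covariance M (\<lambda>x. q x - p x) (\<lambda>x. q x - p x) = 0" for q
  proof -
    obtain c where "AE x in M. q x - p x = c"
      using log_covariance_definite[OF m square_int_diff[OF VD[OF q] ps] zero] by blast
    then show ?thesis
      using VD[OF q] ps by (intro log_class_translate) (auto intro: square_int_measurable)
  qed
  have split_left: "log_covariance M (\<lambda>x. u x - q x) v = - log_covariance M (\<lambda>x. q x - p x) v"
    if "q \<in> V" "v \<in> V" for q v
  proof -
    have "log_covariance M (\<lambda>x. (u x - p x) - (q x - p x)) v =
        log_covariance M (\<lambda>x. u x - p x) v - log_covariance M (\<lambda>x. q x - p x) v"
      using that u p V by (intro log_covariance_diff_left square_int_diff) auto
    then show ?thesis
      using orth[OF that(2)] by simp
  qed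
  have pythagoras: "log_covariance M (\<lambda>x. u x - q x) (\<lambda>x. u x - q x) =
      log_covariance M (\<lambda>x. u x - p x) (\<lambda>x. u x - p x) +
      log_covariance M (\<lambda>x. q x - p x) (\<lambda>x. q x - p x)" if q: "q \<in> V" for q
  proof -
    let ?r = "\<lambda>x. u x - p x" and ?s = "\<lambda>x. q x - p x" and ?t = "\<lambda>x. u x - q x"
    have r: "?r \<in> square_int M" and s: "?s \<in> square_int M" and t: "?t \<in> square_int M"
      using u VD[OF q] ps by (auto intro: square_int_diff)
    have sV: "?s \<in> V"
      using diff[OF q p] .
    have "log_covariance M ?t ?t = log_covariance M (\<lambda>x. ?r x - ?s x) ?t"
      by simp
    also have "\<dots> = log_covariance M ?r ?t - log_covariance M ?s ?t"
      by (rule log_covariance_diff_left[OF r s t])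
    also have "log_covariance M ?s ?t = - log_covariance M ?s ?s"
      using split_left[OF q sV] by (simp add: log_covariance_commute)
    also have "log_covariance M ?r ?t = log_covariance M (\<lambda>x. ?r x - ?s x) ?r"
      by (simp add: log_covariance_commute)
    also have "\<dots> = log_covariance M ?r ?r - log_covariance M ?s ?r"
      by (rule log_covariance_diff_left[OF r s r])
    also have "log_covariance M ?s ?r = 0"
      using orth[OF sV] by (simp add: log_covariance_commute)
    finally show ?thesis by simp
  qed
  show "is_orthogonal_projection M (log_class M ` V) (log_class M u) P \<longleftrightarrow> P = log_class M p"
  proof
    assume proj: "is_orthogonal_projection M (log_class M ` V) (log_class M u) P"
    then obtain q where q: "q \<in> V" "P = log_class M q"
      by (auto simp: is_orthogonal_projection_def)
    let ?s = "\<lambda>x. q x - p x"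
    have "?s \<in> V"
      using diff[OF q(1) p] .
    then have "log_covariance M (\<lambda>x. u x - q x) ?s = 0"
      using proj q inner[of q ?s] by (auto simp: is_orthogonal_projection_def)
    then show "P = log_class M p"
      using split_left[OF q(1) \<open>?s \<in> V\<close>] eqI[OF q(1)] q(2) by simp
  next
    assume "P = log_class M p"
    then show "is_orthogonal_projection M (log_class M ` V) (log_class M u) P"
      using p inner[OF p] orth by (auto simp: is_orthogonal_projection_def)
  qed
  show "is_arg_min (\<lambda>G. bayes_norm M (bayes_minus M (log_class M u) G))
      (\<lambda>G. G \<in> log_class M ` V) P \<longleftrightarrow> P = log_class M p"
  proof
    assume amin: "is_arg_min (\<lambda>G. bayes_norm M (bayes_minus M (log_class M u) G))
      (\<lambda>G. G \<in> log_class M ` V) P"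
    then obtain q where q: "q \<in> V" "P = log_class M q"
      by (auto simp: is_arg_min_def)
    then have "\<not> bayes_norm M (bayes_minus M (log_class M u) (log_class M p)) <
        bayes_norm M (bayes_minus M (log_class M u) (log_class M q))"
      using amin p by (auto simp: is_arg_min_def)
    then have "log_covariance M (\<lambda>x. q x - p x) (\<lambda>x. q x - p x) \<le> 0"
      using pythagoras[OF q(1)] by (simp add: norm p q)
    with log_covariance_nonneg[OF m square_int_diff[OF VD[OF q(1)] ps]]
    show "P = log_class M p"
      using eqI[OF q(1)] q(2) by simp
  next
    assume P: "P = log_class M p"
    have "bayes_norm M (bayes_minus M (log_class M u) (log_class M p)) \<le>
        bayes_norm M (bayes_minus M (log_class M u) (log_class M q))" if q: "q \<in> V" for q
      unfolding norm[OF p] norm[OF q] pythagoras[OF q]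
      using log_covariance_nonneg[OF m square_int_diff[OF VD[OF q] ps]] by simp
    then show "is_arg_min (\<lambda>G. bayes_norm M (bayes_minus M (log_class M u) G))
        (\<lambda>G. G \<in> log_class M ` V) P"
      unfolding P is_arg_min_def using p by (auto simp: not_less)
  qed
qed


section \<open>Averaging over one coordinate\<close>

text \<open>Where a section of \<open>u\<close> fails to be integrable its integral is \<open>0\<close> by convention, so the
  average is a total function; for square integrable \<open>u\<close> this affects a null set of sections only.\<close>

definition section_average :: "'b measure \<Rightarrow> ('a \<times> 'b \<Rightarrow> real) \<Rightarrow> 'a \<Rightarrow> real" where
  "section_average L2 u x = 1 / measure L2 (space L2) * (\<integral>w. u (x, w) \<partial>L2)"

lemma pair_sigma_finite_finite_measures:
  assumes "finite_measure L1" "finite_measure L2"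
  shows "pair_sigma_finite L1 L2"
  using assms by (simp add: pair_sigma_finite_def finite_measure.axioms(1))

lemma square_int_swap:
  assumes "finite_measure L1" "finite_measure L2" and u: "u \<in> square_int (L1 \<Otimes>\<^sub>M L2)"
  shows "(\<lambda>(x, y). u (y, x)) \<in> square_int (L2 \<Otimes>\<^sub>M L1)"
proof -
  interpret pair_sigma_finite L1 L2
    by (rule pair_sigma_finite_finite_measures) fact+
  note [measurable] = square_int_measurable[OF u]
  have "integrable (L2 \<Otimes>\<^sub>M L1) (\<lambda>(x, y). (u (y, x))\<^sup>2)"
    using integrable_product_swap[of "\<lambda>z. (u z)\<^sup>2"] u by (simp add: square_int_def)
  moreover have "(\<lambda>(x, y). u (y, x)) \<in> borel_measurable (L2 \<Otimes>\<^sub>M L1)"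
    by measurable
  ultimately show ?thesis
    by (simp add: square_int_def case_prod_unfold)
qed

lemma square_int_fst:
  assumes "finite_measure L1" "finite_measure L2" and v: "v \<in> square_int L1"
  shows "(\<lambda>z. v (fst z)) \<in> square_int (L1 \<Otimes>\<^sub>M L2)"
proof -
  interpret pair_sigma_finite L1 L2
    by (rule pair_sigma_finite_finite_measures) fact+
  interpret L2: finite_measure L2 by fact
  note [measurable] = square_int_measurable[OF v]
  have "integrable (L1 \<Otimes>\<^sub>M L2) (\<lambda>z. (v (fst z))\<^sup>2)"
    by (rule Fubini_integrable) (use v in \<open>simp_all add: square_int_def\<close>)
  then show ?thesis
    by (simp add: square_int_def)
qed

lemma square_int_snd:
  assumes "finite_measure L1" "finite_measure L2" and v: "v \<in> square_int L2"
  shows "(\<lambda>z. v (snd z)) \<in> square_int (L1 \<Otimes>\<^sub>M L2)"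
  using square_int_swap[OF assms(2,1) square_int_fst[OF assms(2,1) v]]
  by (simp add: case_prod_unfold)

text \<open>Jensen's inequality on almost every section, read off from nonnegativity of the covariance
  form there, bounds the square of the average by the average of the squares.\<close>

lemma square_int_section_average:
  assumes "finite_measure L1" "finite_measure L2" and m2: "measure L2 (space L2) > 0"
    and u: "u \<in> square_int (L1 \<Otimes>\<^sub>M L2)"
  shows "section_average L2 u \<in> square_int L1"
proof -
  interpret pair_sigma_finite L1 L2
    by (rule pair_sigma_finite_finite_measures) fact+
  interpret L2: finite_measure L2 by fact
  let ?m = "measure L2 (space L2)"
  note [measurable] = square_int_measurable[OF u]
  have meas [measurable]: "section_average L2 u \<in> borel_measurable L1"
    unfolding section_average_def by measurable
  have sq: "integrable (L1 \<Otimes>\<^sub>M L2) (\<lambda>z. (u z)\<^sup>2)"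
    using u by (simp add: square_int_def)
  have "integrable L1 (\<lambda>x. (section_average L2 u x)\<^sup>2)"
  proof (rule Bochner_Integration.integrable_bound)
    show "integrable L1 (\<lambda>x. 1 / ?m * (\<integral>w. (u (x, w))\<^sup>2 \<partial>L2))"
      using integrable_fst'[OF sq] by simp
    have "AE x in L1. x \<in> space L1 \<and> integrable L2 (\<lambda>w. (u (x, w))\<^sup>2)"
      using AE_integrable_fst'[OF sq] by auto
    then show "AE x in L1. norm ((section_average L2 u x)\<^sup>2) \<le>
        norm (1 / ?m * (\<integral>w. (u (x, w))\<^sup>2 \<partial>L2))"
    proof eventually_elim
      fix x assume x: "x \<in> space L1 \<and> integrable L2 (\<lambda>w. (u (x, w))\<^sup>2)"
      then have "(\<lambda>w. u (x, w)) \<in> square_int L2"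
        by (simp add: square_int_def)
      from L2.log_covariance_nonneg[OF m2 this]
      have "(\<integral>w. u (x, w) \<partial>L2)\<^sup>2 / ?m \<le> (\<integral>w. (u (x, w))\<^sup>2 \<partial>L2)"
        by (simp add: log_covariance_def power2_eq_square)
      then have "1 / ?m * ((\<integral>w. u (x, w) \<partial>L2)\<^sup>2 / ?m) \<le> 1 / ?m * (\<integral>w. (u (x, w))\<^sup>2 \<partial>L2)"
        using m2 by (intro mult_left_mono) auto
      then show "norm ((section_average L2 u x)\<^sup>2) \<le> norm (1 / ?m * (\<integral>w. (u (x, w))\<^sup>2 \<partial>L2))"
        using m2 by (simp add: section_average_def power2_eq_square)
    qed
  qed measurable
  then show ?thesis
    using meas by (simp add: square_int_def)
qed

text \<open>Integrating first over the averaged coordinate, the factor depending on the other coordinate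
  comes out, and what is left of the residual is zero.\<close>

lemma integral_residual_mult_fst:
  assumes "finite_measure L1" "finite_measure L2" and m2: "measure L2 (space L2) > 0"
    and u: "u \<in> square_int (L1 \<Otimes>\<^sub>M L2)" and v: "v \<in> square_int L1"
  shows "(\<integral>z. (u z - section_average L2 u (fst z)) * v (fst z) \<partial>(L1 \<Otimes>\<^sub>M L2)) = 0"
proof -
  interpret pair_sigma_finite L1 L2
    by (rule pair_sigma_finite_finite_measures) fact+
  interpret L2: finite_measure L2 by fact
  interpret P: finite_measure "L1 \<Otimes>\<^sub>M L2"
    by (rule finite_measure_pair_measure) fact+
  let ?a = "section_average L2 u" and ?m = "measure L2 (space L2)"
  have a: "?a \<in> square_int L1"
    by (rule square_int_section_average) fact+
  note [measurable] = square_int_measurable[OF u] square_int_measurable[OF v]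
    square_int_measurable[OF a]
  have r: "integrable (L1 \<Otimes>\<^sub>M L2) (\<lambda>z. (u z - ?a (fst z)) * v (fst z))"
    using assms(1,2) u v a by (intro integrable_square_int_mult square_int_diff square_int_fst)
  have "(\<integral>z. (u z - ?a (fst z)) * v (fst z) \<partial>(L1 \<Otimes>\<^sub>M L2)) =
      (\<integral>x. (\<integral>w. (u (x, w) - ?a x) * v x \<partial>L2) \<partial>L1)"
    using integral_fst'[OF r] by simp
  also have "\<dots> = (\<integral>x. 0 \<partial>L1)"
  proof (rule integral_cong_AE)
    show "AE x in L1. (\<integral>w. (u (x, w) - ?a x) * v x \<partial>L2) = 0"
      using AE_integrable_fst'[OF P.integrable_square_int[OF u]]
    proof eventually_elim
      fix x assume "integrable L2 (\<lambda>w. u (x, w))"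
      then have "(\<integral>w. u (x, w) - ?a x \<partial>L2) = (\<integral>w. u (x, w) \<partial>L2) - ?m * ?a x"
        by simp
      also have "\<dots> = 0"
        using m2 by (simp add: section_average_def)
      finally show "(\<integral>w. (u (x, w) - ?a x) * v x \<partial>L2) = 0"
        by simp
    qed
  qed measurable
  finally show ?thesis by simp
qed

lemma log_covariance_residual_fst:
  assumes "finite_measure L1" "finite_measure L2" "measure L2 (space L2) > 0"
    and "u \<in> square_int (L1 \<Otimes>\<^sub>M L2)" "v \<in> square_int L1"
  shows "log_covariance (L1 \<Otimes>\<^sub>M L2) (\<lambda>z. u z - section_average L2 u (fst z)) (\<lambda>z. v (fst z)) = 0"
  using integral_residual_mult_fst[OF assms]
    integral_residual_mult_fst[OF assms(1-4) finite_measure.square_int_const[OF assms(1), of 1]]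
  by (simp add: log_covariance_def)

lemma log_covariance_residual_snd:
  assumes fin: "finite_measure L1" "finite_measure L2" and m1: "measure L1 (space L1) > 0"
    and u: "u \<in> square_int (L1 \<Otimes>\<^sub>M L2)" and v: "v \<in> square_int L2"
  shows "log_covariance (L1 \<Otimes>\<^sub>M L2)
    (\<lambda>z. u z - section_average L1 (\<lambda>(y, x). u (x, y)) (snd z)) (\<lambda>z. v (snd z)) = 0"
proof -
  interpret pair_sigma_finite L1 L2
    by (rule pair_sigma_finite_finite_measures) fact+
  let ?u = "\<lambda>(y, x). u (x, y)"
  let ?a = "section_average L1 ?u"
  have us: "?u \<in> square_int (L2 \<Otimes>\<^sub>M L1)"
    using square_int_swap[OF fin u] .
  have a: "?a \<in> square_int L2"
    by (rule square_int_section_average[OF fin(2,1) m1 us])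
  have zero: "(\<integral>z. (u z - ?a (snd z)) * w (snd z) \<partial>(L1 \<Otimes>\<^sub>M L2)) = 0"
    if w: "w \<in> square_int L2" for w
  proof -
    have meas: "(\<lambda>z. (u z - ?a (snd z)) * w (snd z)) \<in> borel_measurable (L1 \<Otimes>\<^sub>M L2)"
      by (intro borel_measurable_times borel_measurable_diff square_int_measurable[OF u]
          measurable_compose[OF measurable_snd square_int_measurable] a w)
    have "(\<integral>z. (u z - ?a (snd z)) * w (snd z) \<partial>(L1 \<Otimes>\<^sub>M L2)) =
        (\<integral>z. (?u z - ?a (fst z)) * w (fst z) \<partial>(L2 \<Otimes>\<^sub>M L1))"
      using integral_product_swap[OF meas] by (simp add: case_prod_unfold)
    also have "\<dots> = 0"
      by (rule integral_residual_mult_fst[OF fin(2,1) m1 us w])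
    finally show ?thesis .
  qed
  show ?thesis
    using zero[OF v] zero[OF finite_measure.square_int_const[OF fin(2), of 1]]
    by (simp add: log_covariance_def)
qed

section \<open>Marginal subspaces and geometric margins\<close>

text \<open>A marginal subspace consists of the classes of products with one factor fixed. The representing
  measures of the other factor therefore have to be known exactly, not only up to
  proportionality.\<close>

lemma (in finite_measure) bayes2_measures_eq:
  "{\<mu>. \<exists>A. A \<in> bayes2 M \<and> \<mu> \<in> A} = (\<lambda>v. density M (\<lambda>x. ennreal (exp (v x)))) ` square_int M"
proof (intro set_eqI iffI)
  fix \<mu> assume "\<mu> \<in> {\<mu>. \<exists>A. A \<in> bayes2 M \<and> \<mu> \<in> A}"
  then obtain A where A: "A \<in> bayes2 M" "\<mu> \<in> A"
    by blast
  note rep = bayes2_representative[OF A]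
  let ?v = "\<lambda>x. ln (bayes_density M \<mu> x)"
  have "density M (\<lambda>x. ennreal (exp (?v x))) = density M (\<lambda>x. ennreal (bayes_density M \<mu> x))"
    using bayes_density_pos[OF rep(1)]
    by (intro density_cong) (auto elim!: eventually_mono)
  also have "\<dots> = \<mu>"
    by (rule density_bayes_density[OF rep(1)])
  finally show "\<mu> \<in> (\<lambda>v. density M (\<lambda>x. ennreal (exp (v x)))) ` square_int M"
    using rep(2) by (intro image_eqI[of _ _ ?v]) auto
next
  fix \<mu> assume "\<mu> \<in> (\<lambda>v. density M (\<lambda>x. ennreal (exp (v x)))) ` square_int M"
  then obtain v where "v \<in> square_int M" "\<mu> = density M (\<lambda>x. ennreal (exp (v x)))"
    by blast
  then show "\<mu> \<in> {\<mu>. \<exists>A. A \<in> bayes2 M \<and> \<mu> \<in> A}"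
    using log_class_in_bayes2[of v] density_exp_in_log_class[of v]
    by (auto dest: square_int_measurable)
qed

lemma bayes_rel_pair_density_fst:
  assumes "finite_measure L2" and [measurable]: "v \<in> borel_measurable L1"
  shows "bayes_rel (L1 \<Otimes>\<^sub>M L2) `` {density L1 (\<lambda>x. ennreal (exp (v x))) \<Otimes>\<^sub>M L2} =
    log_class (L1 \<Otimes>\<^sub>M L2) (\<lambda>z. v (fst z))"
proof -
  have s: "sigma_finite_measure L2"
    using assms(1) by (simp add: finite_measure.axioms(1))
  have "density L1 (\<lambda>x. ennreal (exp (v x))) \<Otimes>\<^sub>M density L2 (\<lambda>y. 1) =
      density (L1 \<Otimes>\<^sub>M L2) (\<lambda>(x, y). ennreal (exp (v x)) * 1)"
    using s by (intro pair_measure_density) (auto simp: density_1)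
  then show ?thesis
    by (simp add: density_1 log_class_def bayes_class_def case_prod_unfold)
qed

lemma bayes_rel_pair_density_snd:
  assumes "finite_measure L2" and v [measurable]: "v \<in> borel_measurable L2"
  shows "bayes_rel (L1 \<Otimes>\<^sub>M L2) `` {L1 \<Otimes>\<^sub>M density L2 (\<lambda>y. ennreal (exp (v y)))} =
    log_class (L1 \<Otimes>\<^sub>M L2) (\<lambda>z. v (snd z))"
proof -
  interpret L2: finite_measure L2 by fact
  have "sigma_finite_measure (density L2 (\<lambda>y. ennreal (exp (v y))))"
    using L2.density_exp_in_log_class[OF v] by (simp add: L2.mem_log_class bayes_measures_def)
  then have "density L1 (\<lambda>x. 1) \<Otimes>\<^sub>M density L2 (\<lambda>y. ennreal (exp (v y))) =
      density (L1 \<Otimes>\<^sub>M L2) (\<lambda>(x, y). 1 * ennreal (exp (v y)))"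
    by (intro pair_measure_density) (auto simp: L2.sigma_finite_measure_axioms)
  then show ?thesis
    by (simp add: density_1 log_class_def bayes_class_def case_prod_unfold)
qed

lemma bayes2_marginal_fst:
  assumes "finite_measure L1" "finite_measure L2"
  shows "bayes2_marginal L1 L2 1 =
    log_class (L1 \<Otimes>\<^sub>M L2) ` (\<lambda>v z. v (fst z)) ` square_int L1"
proof -
  have "bayes2_marginal L1 L2 1 =
      (\<lambda>\<mu>. bayes_rel (L1 \<Otimes>\<^sub>M L2) `` {\<mu> \<Otimes>\<^sub>M L2}) ` {\<mu>. \<exists>A. A \<in> bayes2 L1 \<and> \<mu> \<in> A}"
    unfolding bayes2_marginal_def by auto
  also have "\<dots> = (\<lambda>v. log_class (L1 \<Otimes>\<^sub>M L2) (\<lambda>z. v (fst z))) ` square_int L1"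
    using assms
    by (simp add: finite_measure.bayes2_measures_eq image_image bayes_rel_pair_density_fst
        square_int_measurable cong: image_cong_simp)
  finally show ?thesis
    by (simp add: image_image)
qed

lemma bayes2_marginal_snd:
  assumes "finite_measure L2"
  shows "bayes2_marginal L1 L2 2 =
    log_class (L1 \<Otimes>\<^sub>M L2) ` (\<lambda>v z. v (snd z)) ` square_int L2"
proof -
  have "bayes2_marginal L1 L2 2 =
      (\<lambda>\<mu>. bayes_rel (L1 \<Otimes>\<^sub>M L2) `` {L1 \<Otimes>\<^sub>M \<mu>}) ` {\<mu>. \<exists>A. A \<in> bayes2 L2 \<and> \<mu> \<in> A}"
    unfolding bayes2_marginal_def by auto
  also have "\<dots> = (\<lambda>v. log_class (L1 \<Otimes>\<^sub>M L2) (\<lambda>z. v (snd z))) ` square_int L2"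
    using assms
    by (simp add: finite_measure.bayes2_measures_eq image_image bayes_rel_pair_density_snd
        square_int_measurable cong: image_cong_simp)
  finally show ?thesis
    by (simp add: image_image)
qed

text \<open>Both coordinates reduce to one statement: the margin of a representing density is the class
  of some element \<open>p\<close> of the respective function space that leaves an orthogonal residual.\<close>

lemma margin_density_projection:
  assumes fin: "finite_measure L1" "finite_measure L2"
    and m1: "measure L1 (space L1) > 0" and m2: "measure L2 (space L2) > 0"
    and u: "(\<lambda>z. ln (f z)) \<in> square_int (L1 \<Otimes>\<^sub>M L2)" and i: "i \<in> {1, 2}"
  defines "P \<equiv> L1 \<Otimes>\<^sub>M L2" and "F \<equiv> log_class (L1 \<Otimes>\<^sub>M L2) (\<lambda>z. ln (f z))"
    and "G \<equiv> bayes_class (L1 \<Otimes>\<^sub>M L2) (margin_density L1 L2 i f)"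
  shows "is_orthogonal_projection P (bayes2_marginal L1 L2 i) F Q \<longleftrightarrow> Q = G"
    and "is_arg_min (\<lambda>G. bayes_norm P (bayes_minus P F G)) (\<lambda>G. G \<in> bayes2_marginal L1 L2 i) Q
      \<longleftrightarrow> Q = G"
proof -
  interpret P: finite_measure P
    unfolding P_def by (rule finite_measure_pair_measure) fact+
  interpret L2: finite_measure L2 by fact
  have "emeasure P (space P) = emeasure L1 (space L1) * emeasure L2 (space L2)"
    by (simp add: P_def space_pair_measure L2.emeasure_pair_measure_Times)
  then have m: "measure P (space P) > 0"
    using m1 m2 by (simp add: measure_def enn2real_mult)
  let ?u = "\<lambda>z. ln (f z)"
  have "\<exists>V p. bayes2_marginal L1 L2 i = log_class P ` V \<and> V \<subseteq> square_int P \<and>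
      (\<forall>v\<in>V. \<forall>w\<in>V. (\<lambda>x. v x - w x) \<in> V) \<and> p \<in> V \<and> G = log_class P p \<and>
      (\<forall>v\<in>V. log_covariance P (\<lambda>z. ?u z - p z) v = 0)"
  proof (cases "i = 1")
    case True
    let ?V = "(\<lambda>v z. v (fst z)) ` square_int L1" and ?a = "section_average L2 ?u"
    have "G = log_class P (\<lambda>z. ?a (fst z))"
      by (simp add: G_def P_def log_class_def margin_density_def section_average_def
          case_prod_unfold True)
    then show ?thesis
      using square_int_section_average[OF fin m2 u] fin
      by (intro exI[of _ ?V] exI[of _ "\<lambda>z. ?a (fst z)"])
        (auto simp: P_def True bayes2_marginal_fst[OF fin, simplified] intro!: square_int_fst
          log_covariance_residual_fst[OF fin m2 u] image_eqI[OF _ square_int_diff])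
  next
    case False
    then have i2: "i = 2" using i by simp
    let ?V = "(\<lambda>v z. v (snd z)) ` square_int L2"
      and ?a = "section_average L1 (\<lambda>(y, x). ?u (x, y))"
    have "G = log_class P (\<lambda>z. ?a (snd z))"
      by (simp add: G_def P_def log_class_def margin_density_def section_average_def
          case_prod_unfold i2)
    then show ?thesis
      using square_int_section_average[OF fin(2,1) m1 square_int_swap[OF fin u]] fin
      by (intro exI[of _ ?V] exI[of _ "\<lambda>z. ?a (snd z)"])
        (auto simp: P_def i2 bayes2_marginal_snd[OF fin(2)] intro!: square_int_snd
          log_covariance_residual_snd[OF fin m1 u] image_eqI[OF _ square_int_diff])
  qed
  then obtain V p where V: "bayes2_marginal L1 L2 i = log_class P ` V" "V \<subseteq> square_int P"
      "\<forall>v\<in>V. \<forall>w\<in>V. (\<lambda>x. v x - w x) \<in> V" "p \<in> V" "G = log_class P p"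
      "\<forall>v\<in>V. log_covariance P (\<lambda>z. ?u z - p z) v = 0"
    by (elim exE conjE)
  have F: "F = log_class P ?u" and uP: "?u \<in> square_int P"
    using u by (simp_all add: F_def P_def)
  show "is_orthogonal_projection P (bayes2_marginal L1 L2 i) F Q \<longleftrightarrow> Q = G"
    unfolding V(1) V(5) F
    by (rule P.log_class_projection(1)[OF m uP V(2) V(4)]) (use V(3,6) in simp_all)
  show "is_arg_min (\<lambda>G. bayes_norm P (bayes_minus P F G)) (\<lambda>G. G \<in> bayes2_marginal L1 L2 i) Q
      \<longleftrightarrow> Q = G"
    unfolding V(1) V(5) F
    by (rule P.log_class_projection(2)[OF m uP V(2) V(4)]) (use V(3,6) in simp_all)
qed

theorem proposition3p1:
  fixes L1 :: "'a measure" and L2 :: "'b measure"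
    and F :: "('a \<times> 'b) measure set" and i :: nat
  assumes "finite_measure L1" and "emeasure L1 (space L1) \<noteq> 0"
    and "finite_measure L2" and "emeasure L2 (space L2) \<noteq> 0"
    and "F \<in> bayes2 (L1 \<Otimes>\<^sub>M L2)"
    and "i \<in> {1, 2}"
  shows "(\<forall>P. is_orthogonal_projection (L1 \<Otimes>\<^sub>M L2) (bayes2_marginal L1 L2 i) F P
              \<longleftrightarrow> P = geometric_margin L1 L2 i F)
       \<and> (\<forall>P. is_arg_min (\<lambda>G. bayes_norm (L1 \<Otimes>\<^sub>M L2) (bayes_minus (L1 \<Otimes>\<^sub>M L2) F G))
                (\<lambda>G. G \<in> bayes2_marginal L1 L2 i) P
              \<longleftrightarrow> P = geometric_margin L1 L2 i F)"
proof -
  let ?P = "L1 \<Otimes>\<^sub>M L2"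
  let ?G = "\<lambda>\<mu>. bayes_class ?P (margin_density L1 L2 i (bayes_density ?P \<mu>))"
  interpret L1: finite_measure L1 by fact
  interpret L2: finite_measure L2 by fact
  interpret P: finite_measure ?P
    by (rule finite_measure_pair_measure) fact+
  have m: "measure L1 (space L1) > 0" "measure L2 (space L2) > 0"
    using assms(2,4) by (auto simp: L1.emeasure_eq_measure L2.emeasure_eq_measure less_le)
  note fin = assms(1,3) and F = assms(5)
  have proj: "is_orthogonal_projection ?P (bayes2_marginal L1 L2 i) F Q \<longleftrightarrow> Q = ?G \<mu>"
    and argm: "is_arg_min (\<lambda>G. bayes_norm ?P (bayes_minus ?P F G))
      (\<lambda>G. G \<in> bayes2_marginal L1 L2 i) Q \<longleftrightarrow> Q = ?G \<mu>" if "\<mu> \<in> F" for \<mu> Q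
    using margin_density_projection[OF fin m P.bayes2_representative(2)[OF F that] assms(6)]
      P.bayes2_representative(3)[OF F that] by auto
  obtain \<mu> where mu: "\<mu> \<in> F"
    using bayes2_nonempty[OF P.finite_measure_axioms F] .
  \<comment> \<open>All representatives give the same class, because each gives the unique projection.\<close>
  have "?G \<nu> = ?G \<mu>" if "\<nu> \<in> F" for \<nu>
    using proj[OF mu] proj[OF that] by blast
  then have "geometric_margin L1 L2 i F = ?G \<mu>"
    unfolding geometric_margin_def using mu by blast
  then show ?thesis
    using proj[OF mu] argm[OF mu] by simp
qed

end
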